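(* Let $T_1,T_2\in\mathcal{B}_A(\mathcal{H})$. Then $$w_{\mathbb{A}}^4\left(\begin{bmatrix}O&T_1\\ T_2&O\end{bmatrix}\right)\ge\frac{1}{16}\|P\|_A^2+\frac18 c_A(PT_2T_1+T_2T_1P)+\frac14 m_A^2(T_2T_1),$$ where $P=T_1^{\#_A}T_1+T_2T_2^{\#_A}$ and $m_A(T_2T_1)=\displaystyle\inf_{\theta\in\mathbb{R}}\ \inf_{x\in\mathcal{H},\ \|x\|_A=1}\|Re_A(e^{i\theta}T_2T_1)x\|_A$.
   Context: $\mathcal{H}$ is a complex Hilbert space with inner product $\langle\cdot,\cdot\rangle$, $\mathcal{B}(\mathcal{H})$ is the algebra of bounded linear operators on $\mathcal{H}$, and $A\in\mathcal{B}(\mathcal{H})$ is a nonzero positive operator, i.e. $A$ is selfadjoint and $\langle Ax,x\rangle\ge 0$ for all $x$. Put $\langle x,y\rangle_A=\langle Ax,y\rangle$ and $\|x\|_A=\sqrt{\langle x,x\rangle_A}$. $\mathcal{R}(\cdot)$ denotes range, and $\mathcal{B}_A(\mathcal{H})=\{T\in\mathcal{B}(\mathcal{H}):\mathcal{R}(T^*A)\subseteq\mathcal{R}(A)\}$. For $T\in\mathcal{B}_A(\mathcal{H})$: $T^{\#_A}$ denotes the distinguished $A$-adjoint of $T$, i.e. the unique $X\in\mathcal{B}(\mathcal{H})$ with $AX=T^*A$ and $\mathcal{R}(X)\subseteq\overline{\mathcal{R}(A)}$ (equivalently $T^{\#_A}=A^\dagger T^*A$, with $A^\dagger$ the Moore-Penrose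 inverse of $A$); $Re_A(T)=\frac{T+T^{\#_A}}{2}$; the $A$-operator seminorm is $\|T\|_A=\sup\{\|Tx\|_A/\|x\|_A: x\in\overline{\mathcal{R}(A)},\ x\ne 0\}$; the $A$-numerical radius is $w_A(T)=\sup\{|\langle Tx,x\rangle_A|:x\in\mathcal{H},\ \|x\|_A=1\}$; and the $A$-Crawford number is $c_A(T)=\inf\{|\langle Tx,x\rangle_A|:x\in\mathcal{H},\ \|x\|_A=1\}$. $\mathbb{A}=\mathrm{diag}(A,A)$ is the positive operator on $\mathcal{H}\oplus\mathcal{H}$ with diagonal entries $A$, and $w_{\mathbb{A}}$ is defined in the same way with $\mathcal{H}\oplus\mathcal{H}$ and $\mathbb{A}$ in place of $\mathcal{H}$ and $A$. $w^k(\cdot)$ means $(w(\cdot))^k$ and $m_A^2$ means $(m_A)^2$. $O$ is the null operator on $\mathcal{H}$. *)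

theory Defs
  imports "HOL-Analysis.Analysis"
begin

text \<open>
  The classes below provide complex Hilbert spaces, whose inner product is linear in the first and
  conjugate-linear in the second argument. Building on \<^class>\<open>real_inner\<close>, the norm is
  \<open>norm x = sqrt (Re (cinner x x))\<close>, and positive definiteness of \<open>cinner\<close> is inherited from
  that of \<open>inner = Re cinner\<close>.
\<close>

class complex_inner = real_inner +
  fixes scaleC :: "complex \<Rightarrow> 'a \<Rightarrow> 'a"  (infixr \<open>*\<^sub>C\<close> 75)
    and cinner :: "'a \<Rightarrow> 'a \<Rightarrow> complex"
  assumes scaleC_add_right: "c *\<^sub>C (x + y) = c *\<^sub>C x + c *\<^sub>C y"
    and scaleC_add_left: "(c + d) *\<^sub>C x = c *\<^sub>C x + d *\<^sub>C x"
    and scaleC_scaleC: "c *\<^sub>C d *\<^sub>C x = (c * d) *\<^sub>C x"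
    and scaleR_scaleC: "r *\<^sub>R x = complex_of_real r *\<^sub>C x"
    and cinner_commute: "cinner x y = cnj (cinner y x)"
    and cinner_add_left: "cinner (x + y) z = cinner x z + cinner y z"
    and cinner_scaleC_left: "cinner (c *\<^sub>C x) y = c * cinner x y"
    and inner_eq_Re_cinner: "inner x y = Re (cinner x y)"

class chilbert_space = complex_inner + complete_space

lemma norm_eq_sqrt_cinner: "norm (x :: 'a :: complex_inner) = sqrt (Re (cinner x x))"
  by (simp add: norm_eq_sqrt_inner inner_eq_Re_cinner)

lemma cinner_self_nonneg: "cinner x x \<in> \<real>\<^sub>\<ge>\<^sub>0" for x :: "'a :: complex_inner"
proof -
  have "Im (cinner x x) = - Im (cinner x x)"
    using arg_cong [OF cinner_commute [of x x], of Im] by simp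
  moreover have "Re (cinner x x) \<ge> 0"
    by (metis inner_eq_Re_cinner inner_ge_zero)
  ultimately show ?thesis
    by (simp add: complex_nonneg_Reals_iff)
qed

lemma cinner_self_eq_0_iff: "cinner x x = 0 \<longleftrightarrow> x = 0" for x :: "'a :: complex_inner"
proof
  assume "cinner x x = 0"
  then show "x = 0"
    by (metis inner_eq_Re_cinner inner_eq_zero_iff zero_complex.sel(1))
next
  assume "x = 0"
  then show "cinner x x = 0"
    by (metis add_cancel_right_right cinner_add_left)
qed

instantiation complex :: chilbert_space
begin

definition scaleC_complex :: "complex \<Rightarrow> complex \<Rightarrow> complex"
  where "scaleC_complex c x = c * x"

definition cinner_complex :: "complex \<Rightarrow> complex \<Rightarrow> complex"
  where "cinner_complex x y = x * cnj y"

instance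
  by standard
    (simp_all add: scaleC_complex_def cinner_complex_def algebra_simps scaleR_conv_of_real
      inner_complex_def)

end

text \<open>The orthogonal direct sum; the norm of \<^typ>\<open>'a \<times> 'b\<close> is already the Euclidean one.\<close>

instantiation prod :: (complex_inner, complex_inner) complex_inner
begin

definition scaleC_prod :: "complex \<Rightarrow> 'a \<times> 'b \<Rightarrow> 'a \<times> 'b"
  where "scaleC_prod c x = (c *\<^sub>C fst x, c *\<^sub>C snd x)"

definition cinner_prod :: "'a \<times> 'b \<Rightarrow> 'a \<times> 'b \<Rightarrow> complex"
  where "cinner_prod x y = cinner (fst x) (fst y) + cinner (snd x) (snd y)"

instance
proof
  fix c d :: complex and r :: real and x y z :: "'a \<times> 'b"
  show "c *\<^sub>C (x + y) = c *\<^sub>C x + c *\<^sub>C y"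
    by (simp add: scaleC_prod_def scaleC_add_right)
  show "(c + d) *\<^sub>C x = c *\<^sub>C x + d *\<^sub>C x"
    by (simp add: scaleC_prod_def scaleC_add_left)
  show "c *\<^sub>C d *\<^sub>C x = (c * d) *\<^sub>C x"
    by (simp add: scaleC_prod_def scaleC_scaleC)
  show "r *\<^sub>R x = complex_of_real r *\<^sub>C x"
    by (simp add: scaleC_prod_def scaleR_prod_def scaleR_scaleC)
  show "cinner x y = cnj (cinner y x)"
    by (simp add: cinner_prod_def cinner_commute [symmetric])
  show "cinner (x + y) z = cinner x z + cinner y z"
    by (simp add: cinner_prod_def cinner_add_left)
  show "cinner (c *\<^sub>C x) y = c * cinner x y"
    by (simp add: cinner_prod_def scaleC_prod_def cinner_scaleC_left algebra_simps)
  show "inner x y = Re (cinner x y)"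
    by (simp add: cinner_prod_def inner_prod_def inner_eq_Re_cinner)
qed

end

instance prod :: (chilbert_space, chilbert_space) chilbert_space ..

definition bounded_clinear :: "('a :: complex_inner \<Rightarrow> 'b :: complex_inner) \<Rightarrow> bool"
  where "bounded_clinear T \<longleftrightarrow> bounded_linear T \<and> (\<forall>c x. T (c *\<^sub>C x) = c *\<^sub>C T x)"

definition cadjoint :: "('a :: chilbert_space \<Rightarrow> 'b :: chilbert_space) \<Rightarrow> 'b \<Rightarrow> 'a"
  where "cadjoint T = (THE S. bounded_clinear S \<and> (\<forall>x y. cinner (T x) y = cinner x (S y)))"

definition positive_op :: "('a :: chilbert_space \<Rightarrow> 'a) \<Rightarrow> bool"
  where "positive_op A \<longleftrightarrow>
    bounded_clinear A \<and> cadjoint A = A \<and> (\<forall>x. cinner (A x) x \<in> \<real>\<^sub>\<ge>\<^sub>0)"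

definition A_inner :: "('a :: chilbert_space \<Rightarrow> 'a) \<Rightarrow> 'a \<Rightarrow> 'a \<Rightarrow> complex"
  where "A_inner A x y = cinner (A x) y"

definition A_norm :: "('a :: chilbert_space \<Rightarrow> 'a) \<Rightarrow> 'a \<Rightarrow> real"
  where "A_norm A x = sqrt (Re (A_inner A x x))"

definition B_A :: "('a :: chilbert_space \<Rightarrow> 'a) \<Rightarrow> ('a \<Rightarrow> 'a) set"
  where "B_A A = {T. bounded_clinear T \<and> range (cadjoint T \<circ> A) \<subseteq> range A}"

text \<open>By Douglas' theorem the description in \<open>A_adjoint\<close> is satisfied by exactly one operator
  whenever \<open>A\<close> is positive and \<open>T \<in> B_A A\<close>.\<close>

definition A_adjoint :: "('a :: chilbert_space \<Rightarrow> 'a) \<Rightarrow> ('a \<Rightarrow> 'a) \<Rightarrow> 'a \<Rightarrow> 'a"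
  where "A_adjoint A T =
    (THE X. bounded_clinear X \<and> A \<circ> X = cadjoint T \<circ> A \<and> range X \<subseteq> closure (range A))"

definition Re_A :: "('a :: chilbert_space \<Rightarrow> 'a) \<Rightarrow> ('a \<Rightarrow> 'a) \<Rightarrow> 'a \<Rightarrow> 'a"
  where "Re_A A T = (\<lambda>x. (1/2) *\<^sub>C (T x + A_adjoint A T x))"

text \<open>The suprema and infima below are taken over sets of reals. For \<open>A \<noteq> 0\<close> positive these sets
  are nonempty, the infima are over sets bounded below by 0, and the suprema are over sets that
  are bounded above because every operator in \<open>B_A A\<close> is bounded for the seminorm \<open>A_norm A\<close>.
  In \<open>A_opnorm\<close> no denominator vanishes, since \<open>A\<close> is injective on the closure of its range.\<close>

definition A_opnorm :: "('a :: chilbert_space \<Rightarrow> 'a) \<Rightarrow> ('a \<Rightarrow> 'a) \<Rightarrow> real"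
  where "A_opnorm A T = (SUP x \<in> closure (range A) - {0}. A_norm A (T x) / A_norm A x)"

definition A_numerical_radius :: "('a :: chilbert_space \<Rightarrow> 'a) \<Rightarrow> ('a \<Rightarrow> 'a) \<Rightarrow> real"
  where "A_numerical_radius A T = (SUP x \<in> {x. A_norm A x = 1}. cmod (A_inner A (T x) x))"

definition A_crawford :: "('a :: chilbert_space \<Rightarrow> 'a) \<Rightarrow> ('a \<Rightarrow> 'a) \<Rightarrow> real"
  where "A_crawford A T = (INF x \<in> {x. A_norm A x = 1}. cmod (A_inner A (T x) x))"

definition m_A :: "('a :: chilbert_space \<Rightarrow> 'a) \<Rightarrow> ('a \<Rightarrow> 'a) \<Rightarrow> real"
  where "m_A A S =
    (INF \<theta> \<in> (UNIV :: real set). INF x \<in> {x. A_norm A x = 1}.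
       A_norm A (Re_A A (\<lambda>y. exp (\<i> * complex_of_real \<theta>) *\<^sub>C S y) x))"

text \<open>\<open>op_matrix T11 T12 T21 T22\<close> lists the entries of a 2 by 2 operator matrix row by row.\<close>

definition op_matrix ::
  "('a :: chilbert_space \<Rightarrow> 'a) \<Rightarrow> ('a \<Rightarrow> 'a) \<Rightarrow> ('a \<Rightarrow> 'a) \<Rightarrow> ('a \<Rightarrow> 'a) \<Rightarrow> 'a \<times> 'a \<Rightarrow> 'a \<times> 'a"
  where "op_matrix T11 T12 T21 T22 = (\<lambda>(x, y). (T11 x + T12 y, T21 x + T22 y))"

end

theory Submission
  imports Defs
begin

text \<open>
  Write \<open>\<langle>x, y\<rangle>\<^sub>A\<close> and \<open>\<parallel>x\<parallel>\<^sub>A\<close> for the semi-inner product and seminorm of \<open>A\<close>, \<open>T\<^sup>#\<close> for the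
  \<open>A\<close>-adjoint, \<open>S = T2 T1\<close>, and \<open>w\<close> for the numerical radius of the block operator. For a unit
  complex number \<open>c\<close>, twice the real part of \<open>c\<close> times the block operator is off-diagonal, with
  entries \<open>K = c T1 + cnj c T2\<^sup>#\<close> and \<open>K' = cnj c T1\<^sup># + c T2\<close>. Its quadratic form is bounded by
  \<open>2 w\<close> on unit vectors, so both entries are bounded by \<open>2 w\<close> in the seminorm of \<open>A\<close>. Multiplying out gives
  \<open>K' K = P + 2 R\<close>, where \<open>R = Re\<^sub>A (c\<^sup>2 S)\<close>. Therefore, for every \<open>x\<close> with \<open>\<parallel>x\<parallel>\<^sub>A = 1\<close>,

  \<open>16 w^4 \<ge> \<parallel>P x + 2 R x\<parallel>\<^sub>A\<^sup>2 = \<parallel>P x\<parallel>\<^sub>A\<^sup>2 + 2 Re (c\<^sup>2 \<langle>(P S + S P) x, x\<rangle>\<^sub>A) + 4 \<parallel>R x\<parallel>\<^sub>A\<^sup>2\<close>.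

  For a suitable \<open>c\<close>, depending on \<open>x\<close>, the middle term is \<open>2 \<bar>\<langle>(P S + S P) x, x\<rangle>\<^sub>A\<bar>\<close>, which is at
  least twice the Crawford number, and the last term is at least \<open>4 m\<^sub>A(S)\<^sup>2\<close> for every \<open>c\<close>. The
  supremum over \<open>x\<close> of the first term gives the theorem. The inequality is
  \<open>A_norm_P_plus_Re_le\<close>, the cross term is \<open>Re_A_inner_P_Re\<close>, and \<open>unit_vector_bound\<close> combines them.

  Two analytic facts support this computation. The operator \<open>T\<^sup>#\<close> exists as a bounded operator
  (Douglas): its value at \<open>y\<close> is the orthogonal projection onto the closure of the range of \<open>A\<close> of
  any solution \<open>z\<close> of \<open>A z = T\<^sup>* A y\<close>, where \<open>T\<^sup>*\<close> is the Hilbert space adjoint, and it is bounded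
  by the uniform boundedness principle (\<open>A_adjoint_exists\<close>). Moreover \<open>T\<close> is bounded for the
  seminorm of \<open>A\<close> (Krein), so that \<open>w\<close> is a supremum over a bounded set (\<open>A_bounded\<close>).
\<close>

section \<open>Riesz representation and uniform boundedness\<close>

text \<open>
  The vector \<open>a\<close> minimises \<open>g v = \<parallel>v\<parallel>\<^sup>2 - 2 f v\<close> over \<open>V\<close>: by the parallelogram law every minimising
  sequence of \<open>g\<close> is Cauchy, and the derivative of \<open>g\<close> at the minimiser vanishes along \<open>V\<close>.
  With \<open>V = UNIV\<close> this is the Riesz representation theorem, which provides adjoints. With
  \<open>f v = inner v z\<close> the vector \<open>a\<close> is the orthogonal projection of \<open>z\<close> onto \<open>V\<close>.
\<close>
lemma riesz_on_closed_subspace: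
  fixes f :: "'a :: {real_inner, complete_space} \<Rightarrow> real"
  assumes f: "bounded_linear f" and V: "subspace V" "closed V"
  obtains a where "a \<in> V" and "\<And>v. v \<in> V \<Longrightarrow> f v = inner v a"
proof -
  interpret f: bounded_linear f by (fact f)
  define g where "g v = inner v v - 2 * f v" for v
  obtain K where K: "\<And>v. \<bar>f v\<bar> \<le> norm v * K"
    using f.bounded by auto
  have lower: "- K\<^sup>2 \<le> g v" for v
  proof -
    have "0 \<le> (norm v - K)\<^sup>2" by simp
    also have "\<dots> = inner v v - 2 * (norm v * K) + K\<^sup>2"
      by (simp add: power2_eq_square algebra_simps flip: power2_norm_eq_inner)
    finally show ?thesis
      using K[of v] by (simp add: g_def)
  qed
  define m where "m = (INF v\<in>V. g v)"
  have bdd: "bdd_below (g ` V)"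
    using lower by (auto intro!: bdd_belowI[of _ "- K\<^sup>2"])
  have m_le: "m \<le> g v" if "v \<in> V" for v
    unfolding m_def using bdd that by (rule cINF_lower)
  have "\<exists>v\<in>V. g v < m + inverse (real (Suc n))" for n
  proof -
    have "V \<noteq> {}" using subspace_0[OF V(1)] by auto
    then show ?thesis
      using bdd by (subst cINF_less_iff[symmetric]) (auto simp: m_def)
  qed
  then obtain v where vV: "\<And>n. v n \<in> V" and v: "\<And>n. g (v n) < m + inverse (real (Suc n))"
    by metis
  have par: "(norm (x - y))\<^sup>2 \<le> 2 * (g x - m) + 2 * (g y - m)" if "x \<in> V" "y \<in> V" for x y
  proof -
    have "m \<le> g ((1/2) *\<^sub>R (x + y))"
      by (intro m_le subspace_scale[OF V(1)] subspace_add[OF V(1)] that)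
    moreover have "(norm (x - y))\<^sup>2 = 2 * g x + 2 * g y - 4 * g ((1/2) *\<^sub>R (x + y))"
      by (simp add: g_def f.scaleR f.add power2_norm_eq_inner inner_simps inner_commute
          algebra_simps)
    ultimately show ?thesis by simp
  qed
  have "Cauchy v"
  proof (rule metric_CauchyI)
    fix e :: real assume "e > 0"
    then have "e\<^sup>2 / 4 > 0" by simp
    then obtain N where N: "inverse (real (Suc N)) < e\<^sup>2 / 4"
      using reals_Archimedean by blast
    have "dist (v i) (v j) < e" if "i \<ge> N" "j \<ge> N" for i j
    proof -
      have *: "g (v n) - m < e\<^sup>2 / 4" if "n \<ge> N" for n
      proof -
        have "inverse (real (Suc n)) \<le> inverse (real (Suc N))"
          using that by (simp add: field_simps)
        then show ?thesis using v[of n] N by linarith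
      qed
      have "(norm (v i - v j))\<^sup>2 < e\<^sup>2"
        using par[OF vV[of i] vV[of j]] *[OF that(1)] *[OF that(2)] by (simp add: field_simps)
      then show ?thesis
        using \<open>e > 0\<close> by (simp add: dist_norm power2_less_imp_less)
    qed
    then show "\<exists>N. \<forall>i\<ge>N. \<forall>j\<ge>N. dist (v i) (v j) < e" by blast
  qed
  then obtain a where a: "v \<longlonglongrightarrow> a"
    using convergent_eq_Cauchy convergentD by metis
  have aV: "a \<in> V"
    using closed_sequentially[OF V(2)] vV a by blast
  have "(\<lambda>n. g (v n)) \<longlonglongrightarrow> g a"
    unfolding g_def by (intro tendsto_intros f.tendsto a)
  moreover have "(\<lambda>n. m + inverse (real (Suc n))) \<longlonglongrightarrow> m + 0"
    by (intro tendsto_intros LIMSEQ_inverse_real_of_nat)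
  ultimately have "g a \<le> m"
    using v LIMSEQ_le[of "\<lambda>n. g (v n)" "g a" "\<lambda>n. m + inverse (real (Suc n))" m]
    by (simp add: less_imp_le)
  have "f u = inner u a" if "u \<in> V" for u
  proof -
    define s where "s = inner u a - f u"
    have quad: "0 \<le> 2 * t * s + t\<^sup>2 * inner u u" for t
    proof -
      have "m \<le> g (a + t *\<^sub>R u)"
        by (intro m_le subspace_scale[OF V(1)] subspace_add[OF V(1)] that aV)
      moreover have "g (a + t *\<^sub>R u) = g a + 2 * t * s + t\<^sup>2 * inner u u"
        by (simp add: g_def s_def f.add f.scaleR inner_simps inner_commute power2_eq_square
            algebra_simps)
      ultimately show ?thesis using \<open>g a \<le> m\<close> by linarith
    qed
    \<comment> \<open>The step \<open>t\<close> is a little short of the minimiser, so that \<open>u = 0\<close> needs no case of its own.\<close>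
    define d where "d = inner u u + 1"
    have "d > 0" by (simp add: d_def add_nonneg_pos)
    have "0 \<le> 2 * (- s / d) * s + (- s / d)\<^sup>2 * inner u u" by (rule quad)
    also have "\<dots> = - (s\<^sup>2 * (d + 1)) / d\<^sup>2"
    proof -
      have u: "inner u u = d - 1" by (simp add: d_def)
      show ?thesis unfolding u using \<open>d > 0\<close> by (simp add: field_simps power2_eq_square)
    qed
    finally have "s\<^sup>2 * (d + 1) \<le> 0"
      using \<open>d > 0\<close> by (simp add: field_simps)
    then have "s = 0"
      using \<open>d > 0\<close> by (simp add: mult_le_0_iff)
    then show ?thesis by (simp add: s_def)
  qed
  with aV that show thesis by blast
qed

text \<open>
  The Baire category argument: one of the closed sets \<open>E n\<close> of points at which the whole family is
  bounded by \<open>n\<close> contains a ball, and differences of points of that ball reach every direction.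
\<close>
lemma uniform_boundedness:
  fixes f :: "'i \<Rightarrow> 'a :: {real_normed_vector, complete_space} \<Rightarrow> 'b :: real_normed_vector"
  assumes f: "\<And>i. bounded_linear (f i)"
    and pw: "\<And>x. \<exists>B. \<forall>i. norm (f i x) \<le> B"
  obtains C where "0 \<le> C" and "\<And>i x. norm (f i x) \<le> C * norm x"
proof -
  define E where "E n = (\<Inter>i. {x. norm (f i x) \<le> real n})" for n
  have closed_E: "closed (E n)" for n
    unfolding E_def
    by (intro closed_INT ballI closed_Collect_le continuous_intros
        linear_continuous_on f)
  have "(\<Union>n. E n) = UNIV"
  proof (intro equalityI subset_UNIV subsetI)
    fix x :: 'a
    obtain B where B: "\<forall>i. norm (f i x) \<le> B" using pw by blast
    obtain n where "B \<le> real n" using real_arch_simple by blast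
    with B have "x \<in> E n" by (auto simp: E_def intro: order_trans)
    then show "x \<in> (\<Union>n. E n)" by blast
  qed
  moreover have "interior (\<Union>n. E n) = {}" if "\<And>n. interior (E n) = {}"
    using Met_TC.metric_Baire_category_alt[of "range E"] that closed_E
    by (auto simp: complete_UNIV)
  ultimately obtain n where "interior (E n) \<noteq> {}"
    by auto
  then obtain x0 r where r: "r > 0" and ball: "cball x0 r \<subseteq> E n"
    by (metis all_not_in_conv mem_interior_cball)
  have "norm (f i x) \<le> (2 * real n / r) * norm x" for i x
  proof (cases "x = 0")
    case True
    then show ?thesis by (simp add: linear_simps(3)[OF f])
  next
    case False
    interpret f: bounded_linear "f i" by (fact f)
    define h where "h = (r / norm x) *\<^sub>R x"
    have "norm h = r" using False r by (simp add: h_def)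
    then have "x0 + h \<in> E n" "x0 \<in> E n" using ball r by (auto simp: dist_norm)
    then have "norm (f i (x0 + h)) \<le> n" "norm (f i x0) \<le> n" by (auto simp: E_def)
    moreover have "f i h = f i (x0 + h) - f i x0" by (simp add: f.add)
    ultimately have "norm (f i h) \<le> 2 * real n"
      using norm_triangle_ineq4[of "f i (x0 + h)" "f i x0"] by simp
    then show ?thesis
      using False r by (simp add: h_def f.scaleR field_simps)
  qed
  then show thesis using r by (intro that[of "2 * real n / r"]) auto
qed

lemma subspace_closure:
  fixes S :: "'a :: real_normed_vector set"
  assumes "subspace S"
  shows "subspace (closure S)"
proof (rule subspaceI)
  show "0 \<in> closure S" using subspace_0[OF assms] closure_subset by blast
next
  fix x y assume "x \<in> closure S" "y \<in> closure S"
  then obtain f g where "\<forall>n. f n \<in> S" "f \<longlonglongrightarrow> x" "\<forall>n. g n \<in> S" "g \<longlonglongrightarrow> y"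
    unfolding closure_sequential by blast
  then show "x + y \<in> closure S"
    unfolding closure_sequential
    by (intro exI[of _ "\<lambda>n. f n + g n"]) (simp add: tendsto_add subspace_add[OF assms])
next
  fix c :: real and x assume "x \<in> closure S"
  then obtain f where "\<forall>n. f n \<in> S" "f \<longlonglongrightarrow> x"
    unfolding closure_sequential by blast
  then show "c *\<^sub>R x \<in> closure S"
    unfolding closure_sequential
    by (intro exI[of _ "\<lambda>n. c *\<^sub>R f n"]) (simp add: tendsto_scaleR subspace_scale[OF assms])
qed


section \<open>Complex inner products and adjoints\<close>

lemma scaleC_one [simp]: "1 *\<^sub>C x = x" for x :: "'a :: complex_inner"
  using scaleR_scaleC[of 1 x] by simp

lemma cinner_add_right: "cinner x (y + z) = cinner x y + cinner x z"
  by (metis cinner_add_left cinner_commute complex_cnj_add)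

lemma cinner_scaleC_right: "cinner x (c *\<^sub>C y) = cnj c * cinner x y"
  by (metis cinner_commute cinner_scaleC_left complex_cnj_mult)

lemma Im_cinner: "Im (cinner x y) = - inner (\<i> *\<^sub>C x) y"
  by (simp add: inner_eq_Re_cinner cinner_scaleC_left)

lemma norm_scaleC: "norm (c *\<^sub>C x) = cmod c * norm x"
proof -
  have "cinner (c *\<^sub>C x) (c *\<^sub>C x) = complex_of_real ((cmod c)\<^sup>2) * cinner x x"
    by (simp only: cinner_scaleC_left cinner_scaleC_right complex_norm_square mult_ac)
  then show ?thesis
    by (simp add: norm_eq_sqrt_cinner[where x = x] norm_eq_sqrt_cinner[where x = "c *\<^sub>C x"]
        real_sqrt_mult)
qed

lemma bounded_clinearI:
  assumes "\<And>x y. T (x + y) = T x + T y" and "\<And>c x. T (c *\<^sub>C x) = c *\<^sub>C T x"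
    and "\<And>x. norm (T x) \<le> norm x * K"
  shows "bounded_clinear T"
  unfolding bounded_clinear_def
  using assms by (auto intro!: bounded_linear_intro[where K = K] simp: scaleR_scaleC)

lemma bounded_clinear_scaleC:
  assumes "bounded_clinear T"
  shows "bounded_clinear (\<lambda>x. c *\<^sub>C T x)"
proof -
  interpret bounded_linear T using assms by (simp add: bounded_clinear_def)
  obtain K where K: "\<And>x. norm (T x) \<le> norm x * K" using bounded by blast
  show ?thesis
  proof (rule bounded_clinearI)
    show "norm (c *\<^sub>C T x) \<le> norm x * (cmod c * K)" for x
      using mult_left_mono[OF K[of x], of "cmod c"] by (simp add: norm_scaleC mult_ac)
  qed (use assms in \<open>simp_all add: add scaleC_add_right scaleC_scaleC bounded_clinear_def mult_ac\<close>)
qed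

lemma bounded_clinear_compose:
  "bounded_clinear S \<Longrightarrow> bounded_clinear T \<Longrightarrow> bounded_clinear (\<lambda>x. S (T x))"
  by (auto simp: bounded_clinear_def bounded_linear_compose)

lemma bounded_clinear_simps:
  assumes "bounded_clinear T"
  shows "T (x + y) = T x + T y" "T (c *\<^sub>C x) = c *\<^sub>C T x"
  using assms by (auto simp: bounded_clinear_def linear_simps)

text \<open>
  Complex linearity turns an identity of real inner products into one of complex inner products,
  because the imaginary part of \<open>cinner x y\<close> is a real inner product with \<open>\<i> *\<^sub>C x\<close>. So
  representing vectors of real functionals yield complex adjoints.
\<close>
lemma cinner_eq_of_inner_eq:
  assumes T: "bounded_clinear T" and eq: "\<And>x. inner (T x) y = inner x s"
  shows "cinner (T x) y = cinner x s"
proof (rule complex_eqI)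
  show "Re (cinner (T x) y) = Re (cinner x s)"
    using eq by (simp add: inner_eq_Re_cinner)
  show "Im (cinner (T x) y) = Im (cinner x s)"
    using eq by (simp add: Im_cinner bounded_clinear_simps(2)[OF T, symmetric])
qed

lemma cinner_right_cancel:
  assumes "\<And>z. cinner z x = cinner z y"
  shows "x = y"
proof -
  have "inner z x = inner z y" for z
    using assms by (simp add: inner_eq_Re_cinner)
  then show ?thesis by (metis vector_eq_ldot)
qed

lemma cadjoint:
  fixes T :: "'a :: chilbert_space \<Rightarrow> 'b :: chilbert_space"
  assumes T: "bounded_clinear T"
  shows bounded_clinear_cadjoint: "bounded_clinear (cadjoint T)"
    and cinner_cadjoint: "cinner (T x) y = cinner x (cadjoint T y)"
proof -
  have bl: "bounded_linear T" using T by (simp add: bounded_clinear_def)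
  obtain K where K: "\<And>x. norm (T x) \<le> norm x * K" and "K \<ge> 0"
    using bounded_linear.nonneg_bounded[OF bl] by blast
  have "\<exists>s. \<forall>x. cinner (T x) y = cinner x s" for y
  proof -
    have "bounded_linear (\<lambda>x. inner (T x) y)"
      using bl by (rule bounded_linear_compose[OF bounded_linear_inner_left])
    then obtain s where "\<And>x. inner (T x) y = inner x s"
      by (rule riesz_on_closed_subspace[of _ UNIV]) auto
    then show ?thesis
      using cinner_eq_of_inner_eq[OF T] by blast
  qed
  then obtain S where S: "\<And>x y. cinner (T x) y = cinner x (S y)" by metis
  have "bounded_clinear S"
  proof (rule bounded_clinearI)
    show "S (x + y) = S x + S y" for x y
      by (rule cinner_right_cancel) (simp add: cinner_add_right flip: S)
    show "S (c *\<^sub>C x) = c *\<^sub>C S x" for c x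
      by (rule cinner_right_cancel) (simp add: cinner_scaleC_right flip: S)
    show "norm (S y) \<le> norm y * K" for y
    proof -
      have "norm (S y) * norm (S y) = inner (T (S y)) y"
        by (metis S inner_eq_Re_cinner power2_eq_square power2_norm_eq_inner)
      also have "\<dots> \<le> norm (T (S y)) * norm y" by (rule norm_cauchy_schwarz)
      also have "\<dots> \<le> norm (S y) * K * norm y" by (intro mult_right_mono K) simp
      finally have "norm (S y) * norm (S y) \<le> norm (S y) * (norm y * K)" by (simp add: mult_ac)
      then show ?thesis
        using \<open>K \<ge> 0\<close> by (cases "S y = 0") auto
    qed
  qed
  have "cadjoint T = S"
    unfolding cadjoint_def
  proof (rule the_equality)
    show "bounded_clinear S \<and> (\<forall>x y. cinner (T x) y = cinner x (S y))"
      using \<open>bounded_clinear S\<close> S by blast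
  next
    fix S' assume S': "bounded_clinear S' \<and> (\<forall>x y. cinner (T x) y = cinner x (S' y))"
    show "S' = S"
    proof
      show "S' y = S y" for y
        by (rule cinner_right_cancel) (metis S S')
    qed
  qed
  then show "bounded_clinear (cadjoint T)" "cinner (T x) y = cinner x (cadjoint T y)"
    using \<open>bounded_clinear S\<close> S by blast+
qed

lemma phase_rotation: "exp (\<i> * complex_of_real (- Arg z)) * z = complex_of_real (cmod z)"
proof -
  have "cis (- Arg z) * rcis (cmod z) (Arg z) = complex_of_real (cmod z)"
    by (simp add: rcis_def cis_mult mult.left_commute)
  then show ?thesis by (simp add: rcis_cmod_Arg cis_conv_exp)
qed

section \<open>Existence of the A-adjoint\<close>

context
  fixes A :: "'a :: chilbert_space \<Rightarrow> 'a"
  assumes A: "positive_op A"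
begin

lemma bounded_clinear_A: "bounded_clinear A"
  using A by (simp add: positive_op_def)

lemma bounded_linear_A: "bounded_linear A"
  using bounded_clinear_A by (simp add: bounded_clinear_def)

lemma selfadjoint_A: "cinner (A x) y = cinner x (A y)"
  using cinner_cadjoint[OF bounded_clinear_A] A by (simp add: positive_op_def)

lemma inner_selfadjoint_A: "inner (A x) y = inner x (A y)"
  by (simp add: inner_eq_Re_cinner selfadjoint_A)

lemma A_diff: "A (x - y) = A x - A y"
  using bounded_linear_A by (simp add: linear_simps)

lemma subspace_closure_range: "subspace (closure (range A))"
  by (intro subspace_closure linear_subspace_image bounded_linear.linear bounded_linear_A subspace_UNIV)

lemma closure_range_scaleC:
  assumes "x \<in> closure (range A)"
  shows "c *\<^sub>C x \<in> closure (range A)"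
proof -
  have "bounded_clinear (\<lambda>x :: 'a. c *\<^sub>C x)"
    by (rule bounded_clinear_scaleC) (simp add: bounded_clinear_def bounded_linear_ident)
  then have "continuous_on (closure (range A)) (\<lambda>x. c *\<^sub>C x)"
    by (simp add: bounded_clinear_def linear_continuous_on)
  moreover have "c *\<^sub>C A x \<in> range A" for x
    using bounded_clinear_simps(2)[OF bounded_clinear_A, of c x] by (metis rangeI)
  ultimately have "(\<lambda>x. c *\<^sub>C x) ` closure (range A) \<subseteq> closure (range A)"
    by (intro image_closure_subset) (auto intro: subsetD[OF closure_subset])
  then show ?thesis using assms by blast
qed

text \<open>
  A vector of the closure of the range is recovered, norm included, from its inner products with
  the range itself. The case \<open>C = 0\<close> says that the closure of the range meets its orthogonal
  complement, the kernel of \<open>A\<close>, only in \<open>0\<close>.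
\<close>
lemma norm_le_on_closure_range:
  assumes "x \<in> closure (range A)" and "0 \<le> C" and "\<And>u. inner x (A u) \<le> C * norm (A u)"
  shows "norm x \<le> C"
proof -
  have "closure (range A) \<subseteq> {v. inner x v \<le> C * norm v}"
    using assms(3)
    by (intro closure_minimal closed_Collect_le continuous_intros) auto
  then have "norm x * norm x \<le> C * norm x"
    using assms(1) by (auto simp: norm_eq_sqrt_inner)
  then show ?thesis using assms(2) by (cases "x = 0") auto
qed

lemma inj_on_closure_range: "inj_on A (closure (range A))"
proof (rule inj_onI)
  fix x y assume xy: "x \<in> closure (range A)" "y \<in> closure (range A)" and eq: "A x = A y"
  have "inner (x - y) (A u) \<le> 0 * norm (A u)" for u
    by (simp add: eq A_diff flip: inner_selfadjoint_A)
  then have "norm (x - y) \<le> 0"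
    using subspace_diff[OF subspace_closure_range xy] by (intro norm_le_on_closure_range) auto
  then show "x = y" by simp
qed

text \<open>
  The vector \<open>p\<close> is the orthogonal projection of \<open>z\<close>; the difference \<open>z - p\<close> is orthogonal to the
  range of the selfadjoint operator \<open>A\<close>, hence in its kernel.
\<close>
lemma preimage_in_closure_range:
  obtains p where "p \<in> closure (range A)" "A p = A z"
proof -
  obtain p where p: "p \<in> closure (range A)"
    and orth: "\<And>v. v \<in> closure (range A) \<Longrightarrow> inner v z = inner v p"
    using riesz_on_closed_subspace[OF bounded_linear_inner_left[of z] subspace_closure_range
        closed_closure] by blast
  have "inner u (A p) = inner u (A z)" for u
    using orth[OF subsetD[OF closure_subset rangeI], of u] by (simp flip: inner_selfadjoint_A)
  then have "A p = A z" by (metis vector_eq_ldot)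
  with p that show thesis by blast
qed

text \<open>
  Since \<open>A\<close> is injective on the closure of its range, an operator with values there is determined
  by its \<open>A\<close>-inner products. This description computes \<open>A\<close>-adjoints of products and multiples.
\<close>
lemma A_adjoint_eqI:
  assumes T: "bounded_clinear T" and X: "bounded_clinear X"
    and sub: "range X \<subseteq> closure (range A)"
    and adj: "\<And>x y. A_inner A (T x) y = A_inner A x (X y)"
  shows "A_adjoint A T = X"
proof -
  have AX: "A (X y) = cadjoint T (A y)" for y
  proof (rule cinner_right_cancel)
    fix z
    have "cinner z (A (X y)) = A_inner A (T z) y"
      by (simp add: adj) (simp add: A_inner_def selfadjoint_A)
    also have "\<dots> = cinner z (cadjoint T (A y))"
      by (simp add: A_inner_def selfadjoint_A cinner_cadjoint[OF T])
    finally show "cinner z (A (X y)) = cinner z (cadjoint T (A y))" .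
  qed
  show ?thesis
    unfolding A_adjoint_def
  proof (rule the_equality)
    show "bounded_clinear X \<and> A \<circ> X = cadjoint T \<circ> A \<and> range X \<subseteq> closure (range A)"
      using X sub AX by auto
  next
    fix Y assume Y: "bounded_clinear Y \<and> A \<circ> Y = cadjoint T \<circ> A \<and> range Y \<subseteq> closure (range A)"
    show "Y = X"
    proof
      fix y
      have "A (Y y) = A (X y)" using Y AX by (auto dest: fun_cong[of _ _ y])
      moreover have "Y y \<in> closure (range A)" "X y \<in> closure (range A)"
        using Y sub by auto
      ultimately show "Y y = X y" by (rule inj_onD[OF inj_on_closure_range])
    qed
  qed
qed

text \<open>
  This is the part of Douglas' theorem that gives \<open>A \<circ> X = cadjoint T \<circ> A\<close>. The values of \<open>X\<close> are the
  unique solutions in the closure of the range of \<open>A\<close>, and uniqueness makes \<open>X\<close> linear. Boundedness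
  comes from uniform boundedness: \<open>inner (X y) (A u) = inner y (A (T u))\<close> is bounded in \<open>y\<close> for
  each fixed \<open>u\<close>, and after division by \<open>norm (A u)\<close> it is bounded by \<open>norm (X y)\<close> for each fixed \<open>y\<close>.
\<close>
lemma A_adjoint_exists:
  assumes "T \<in> B_A A"
  obtains X where "bounded_clinear X" "range X \<subseteq> closure (range A)"
    "\<And>x y. A_inner A (T x) y = A_inner A x (X y)"
proof -
  have T: "bounded_clinear T" and ran: "range (cadjoint T \<circ> A) \<subseteq> range A"
    using assms by (auto simp: B_A_def)
  have "\<exists>z. z \<in> closure (range A) \<and> A z = cadjoint T (A y)" for y
  proof -
    obtain z where "cadjoint T (A y) = A z" using ran by auto
    then show ?thesis by (metis preimage_in_closure_range)
  qed
  then obtain X where XV: "\<And>y. X y \<in> closure (range A)"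
    and AX: "\<And>y. A (X y) = cadjoint T (A y)" by metis
  have adj: "A_inner A (T x) y = A_inner A x (X y)" for x y
    by (simp add: A_inner_def selfadjoint_A cinner_cadjoint[OF T] AX)
  have XA: "inner (X y) (A u) = inner y (A (T u))" for u y
  proof -
    have "inner (X y) (A u) = Re (A_inner A u (X y))"
      by (simp add: A_inner_def inner_eq_Re_cinner[symmetric] inner_commute)
    also have "\<dots> = inner y (A (T u))"
      by (simp add: adj[symmetric]) (simp add: A_inner_def inner_eq_Re_cinner[symmetric] inner_commute)
    finally show ?thesis .
  qed
  have "bounded_linear (\<lambda>y. inner y (A (T u)) / norm (A u))" for u
    by (intro bounded_linear_divide[THEN bounded_linear_compose] bounded_linear_inner_left)
  moreover have "\<exists>B. \<forall>u. norm (inner y (A (T u)) / norm (A u)) \<le> B" for y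
  proof (intro exI[of _ "norm (X y)"] allI)
    fix u
    have "\<bar>inner (X y) (A u)\<bar> \<le> norm (X y) * norm (A u)" by (rule Cauchy_Schwarz_ineq2)
    then show "norm (inner y (A (T u)) / norm (A u)) \<le> norm (X y)"
      by (cases "A u = 0") (auto simp: field_simps simp flip: XA)
  qed
  ultimately obtain C where "0 \<le> C" and C: "\<And>u y. norm (inner y (A (T u)) / norm (A u)) \<le> C * norm y"
    using uniform_boundedness[of "\<lambda>u y. inner y (A (T u)) / norm (A u)"] by blast
  have bd: "norm (X y) \<le> norm y * C" for y
  proof (rule norm_le_on_closure_range[OF XV])
    show "0 \<le> norm y * C" using \<open>0 \<le> C\<close> by simp
    show "inner (X y) (A u) \<le> norm y * C * norm (A u)" for u
      using C[of y u] by (cases "A u = 0") (auto simp: XA abs_le_iff field_simps)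
  qed
  have "bounded_clinear X"
  proof (rule bounded_clinearI)
    note lin = bounded_clinear_simps[OF bounded_clinear_A]
      bounded_clinear_simps[OF bounded_clinear_cadjoint[OF T]]
    show "X (x + y) = X x + X y" for x y
      by (rule inj_onD[OF inj_on_closure_range])
        (simp_all add: AX lin XV subspace_add[OF subspace_closure_range])
    show "X (c *\<^sub>C x) = c *\<^sub>C X x" for c x
      by (rule inj_onD[OF inj_on_closure_range])
        (simp_all add: AX lin XV closure_range_scaleC)
  qed (rule bd)
  with adj XV that show thesis by blast
qed

lemma A_adjoint:
  assumes "T \<in> B_A A"
  shows bounded_clinear_A_adjoint: "bounded_clinear (A_adjoint A T)"
    and range_A_adjoint: "A_adjoint A T y \<in> closure (range A)"
    and A_inner_A_adjoint: "A_inner A (T x) y = A_inner A x (A_adjoint A T y)"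
proof -
  obtain X where X: "bounded_clinear X" "range X \<subseteq> closure (range A)"
    "\<And>x y. A_inner A (T x) y = A_inner A x (X y)"
    using assms by (rule A_adjoint_exists) blast
  moreover have "A_adjoint A T = X"
    using assms X by (intro A_adjoint_eqI) (auto simp: B_A_def)
  ultimately show "bounded_clinear (A_adjoint A T)" "A_adjoint A T y \<in> closure (range A)"
    "A_inner A (T x) y = A_inner A x (A_adjoint A T y)"
    by auto
qed

section \<open>The seminorm of A\<close>

lemma A_inner_simps:
  "A_inner A (x + y) z = A_inner A x z + A_inner A y z"
  "A_inner A x (y + z) = A_inner A x y + A_inner A x z"
  "A_inner A (c *\<^sub>C x) y = c * A_inner A x y"
  "A_inner A x (c *\<^sub>C y) = cnj c * A_inner A x y"
  by (simp_all add: A_inner_def bounded_clinear_simps[OF bounded_clinear_A] cinner_add_left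
      cinner_add_right cinner_scaleC_left cinner_scaleC_right)

lemma A_inner_commute: "A_inner A x y = cnj (A_inner A y x)"
  by (metis A_inner_def cinner_commute selfadjoint_A)

lemma Re_A_inner_commute: "Re (A_inner A x y) = Re (A_inner A y x)"
  by (subst A_inner_commute) simp

lemma A_inner_self: "A_inner A x x = complex_of_real ((A_norm A x)\<^sup>2)"
proof -
  have "A_inner A x x \<in> \<real>\<^sub>\<ge>\<^sub>0" using A by (simp add: positive_op_def A_inner_def)
  then show ?thesis
    by (auto simp: A_norm_def complex_nonneg_Reals_iff complex_eq_iff)
qed

lemma A_norm_nonneg: "0 \<le> A_norm A x"
  using A by (simp add: A_norm_def A_inner_def positive_op_def complex_nonneg_Reals_iff)

lemma A_norm_scaleC: "A_norm A (c *\<^sub>C x) = cmod c * A_norm A x"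
proof -
  have "complex_of_real ((A_norm A (c *\<^sub>C x))\<^sup>2) = c * cnj c * A_inner A x x"
    by (simp only: A_inner_simps mult_ac flip: A_inner_self)
  also have "\<dots> = complex_of_real ((cmod c * A_norm A x)\<^sup>2)"
    by (simp only: A_inner_self power_mult_distrib of_real_mult complex_norm_square)
  finally have "complex_of_real ((A_norm A (c *\<^sub>C x))\<^sup>2) = complex_of_real ((cmod c * A_norm A x)\<^sup>2)" .
  then show ?thesis
    by (simp only: of_real_eq_iff) (simp add: A_norm_nonneg power2_eq_iff_nonneg)
qed

lemma A_norm_add_square:
  "(A_norm A (x + y))\<^sup>2 = (A_norm A x)\<^sup>2 + 2 * Re (A_inner A x y) + (A_norm A y)\<^sup>2"
proof -
  have "(A_norm A (x + y))\<^sup>2 = Re (A_inner A (x + y) (x + y))" by (simp add: A_inner_self)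
  also have "\<dots> = (A_norm A x)\<^sup>2 + 2 * Re (A_inner A x y) + (A_norm A y)\<^sup>2"
    by (simp only: A_inner_simps) (simp add: A_inner_self Re_A_inner_commute[of y x])
  finally show ?thesis .
qed

lemma A_Cauchy_Schwarz: "cmod (A_inner A x y) \<le> A_norm A x * A_norm A y"
proof -
  define r where "r = cmod (A_inner A x y)"
  define c where "c = exp (\<i> * complex_of_real (- Arg (A_inner A x y)))"
  have c: "cmod c = 1" "c * A_inner A x y = complex_of_real r"
    unfolding c_def r_def by (simp_all only: norm_exp_i_times phase_rotation)
  have quad: "0 \<le> (A_norm A x)\<^sup>2 + 2 * t * r + t\<^sup>2 * (A_norm A y)\<^sup>2" for t
  proof -
    have "0 \<le> (A_norm A (c *\<^sub>C x + complex_of_real t *\<^sub>C y))\<^sup>2" by simp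
    also have "\<dots> = (A_norm A x)\<^sup>2 + 2 * t * r + t\<^sup>2 * (A_norm A y)\<^sup>2"
      by (simp add: A_norm_add_square A_norm_scaleC A_inner_simps c power_mult_distrib)
    finally show ?thesis .
  qed
  have "r\<^sup>2 \<le> (A_norm A x)\<^sup>2 * (A_norm A y)\<^sup>2"
  proof (cases "A_norm A y = 0")
    case True
    have "r = 0"
    proof (rule ccontr)
      assume "r \<noteq> 0"
      \<comment> \<open>When \<open>y\<close> has seminorm \<open>0\<close> the quadratic in \<open>t\<close> is affine, and it is negative at the
        point \<open>t\<close> used here.\<close>
      then have "2 * (- ((A_norm A x)\<^sup>2 + 1) / r) * r = - 2 * ((A_norm A x)\<^sup>2 + 1)"
        by simp
      then have "0 \<le> - (A_norm A x)\<^sup>2 - 2"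
        using quad[of "- ((A_norm A x)\<^sup>2 + 1) / r"] True by simp
      then show False using zero_le_power2[of "A_norm A x"] by linarith
    qed
    then show ?thesis by simp
  next
    case False
    define b where "b = (A_norm A y)\<^sup>2"
    have "b > 0" using False by (simp add: b_def)
    have "0 \<le> (A_norm A x)\<^sup>2 + 2 * (- r / b) * r + (- r / b)\<^sup>2 * b"
      using quad[of "- r / b"] by (simp add: b_def)
    also have "\<dots> = (A_norm A x)\<^sup>2 - r\<^sup>2 / b"
      using \<open>b > 0\<close> by (simp add: field_simps power2_eq_square)
    finally show ?thesis
      using \<open>b > 0\<close> by (simp add: field_simps flip: b_def)
  qed
  then have "r\<^sup>2 \<le> (A_norm A x * A_norm A y)\<^sup>2" by (simp only: power_mult_distrib)
  then show ?thesis
    unfolding r_def by (rule power2_le_imp_le) (simp add: A_norm_nonneg)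
qed

lemma ex_A_norm_one:
  assumes "A \<noteq> (\<lambda>x. 0)"
  obtains x where "A_norm A x = 1"
proof -
  have "\<exists>x. A_norm A x \<noteq> 0"
  proof (rule ccontr)
    assume "\<not> ?thesis"
    then have "cmod (A_inner A x (A x)) \<le> 0" for x
      using A_Cauchy_Schwarz[of x "A x"] by simp
    then have "A x = 0" for x
      by (simp add: A_inner_def cinner_self_eq_0_iff)
    with assms show False by auto
  qed
  then obtain x where "A_norm A x \<noteq> 0" by blast
  then have "A_norm A (complex_of_real (1 / A_norm A x) *\<^sub>C x) = 1"
    by (simp add: A_norm_scaleC norm_divide A_norm_nonneg del: of_real_divide)
  with that show thesis by blast
qed

section \<open>Boundedness for the seminorm\<close>

lemma A_norm_le_norm:
  obtains M where "\<And>x. A_norm A x \<le> M * norm x"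
proof -
  obtain k where k: "\<And>x. norm (A x) \<le> norm x * k" and "k \<ge> 0"
    using bounded_linear.nonneg_bounded[OF bounded_linear_A] by blast
  have "A_norm A x \<le> sqrt k * norm x" for x
  proof -
    have "inner (A x) x \<le> norm (A x) * norm x" by (rule norm_cauchy_schwarz)
    also have "\<dots> \<le> (norm x * k) * norm x" by (intro mult_right_mono k) simp
    finally have "A_norm A x \<le> sqrt (k * (norm x)\<^sup>2)"
      by (simp add: A_norm_def A_inner_def power2_eq_square mult_ac flip: inner_eq_Re_cinner)
    then show ?thesis by (simp add: real_sqrt_mult)
  qed
  with that show thesis by blast
qed

text \<open>
  Krein's argument. The Cauchy-Schwarz inequality gives
  \<open>\<parallel>S\<^sup>m x\<parallel>\<^sub>A\<^sup>2 = \<langle>x, S\<^sup>2\<^sup>m x\<rangle>\<^sub>A \<le> \<parallel>S\<^sup>2\<^sup>m x\<parallel>\<^sub>A\<close>; by repeated doubling of the exponent,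
  \<open>\<parallel>S x\<parallel>\<^sub>A\<close> to the power \<open>2 ^ n\<close> is at most \<open>\<parallel>S ^ (2 ^ n) x\<parallel>\<^sub>A\<close>, hence at most a constant times \<open>K\<close>
  to the same power. As \<open>n\<close> grows this forces \<open>\<parallel>S x\<parallel>\<^sub>A \<le> K\<close>.
\<close>
lemma A_selfadjoint_bounded:
  assumes S: "\<And>x y. A_inner A (S x) y = A_inner A x (S y)"
    and K: "\<And>x. norm (S x) \<le> K * norm x" and "0 < K"
    and x: "A_norm A x = 1"
  shows "A_norm A (S x) \<le> K"
proof (rule ccontr)
  assume "\<not> A_norm A (S x) \<le> K"
  then have q: "1 < A_norm A (S x) / K" using \<open>0 < K\<close> by simp
  have move: "A_inner A ((S ^^ m) u) v = A_inner A u ((S ^^ m) v)" for m u v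
    by (induction m arbitrary: u v) (simp_all add: S funpow_swap1)
  have double: "(A_norm A ((S ^^ m) x))\<^sup>2 \<le> A_norm A ((S ^^ (2 * m)) x)" for m
  proof -
    have "(A_norm A ((S ^^ m) x))\<^sup>2 = Re (A_inner A x ((S ^^ (2 * m)) x))"
      using A_inner_self[of "(S ^^ m) x"] by (simp add: move mult_2 funpow_add)
    also have "\<dots> \<le> cmod (A_inner A x ((S ^^ (2 * m)) x))" by (rule complex_Re_le_cmod)
    also have "\<dots> \<le> A_norm A ((S ^^ (2 * m)) x)"
      using A_Cauchy_Schwarz[of x "(S ^^ (2 * m)) x"] x by simp
    finally show ?thesis .
  qed
  have lower: "A_norm A (S x) ^ 2 ^ n \<le> A_norm A ((S ^^ (2 ^ n)) x)" for n
  proof (induction n)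
    case (Suc n)
    have "A_norm A (S x) ^ 2 ^ Suc n = (A_norm A (S x) ^ 2 ^ n)\<^sup>2"
      by (simp add: mult.commute flip: power_mult)
    also have "\<dots> \<le> (A_norm A ((S ^^ (2 ^ n)) x))\<^sup>2"
      by (intro power_mono Suc) (simp add: A_norm_nonneg)
    also have "\<dots> \<le> A_norm A ((S ^^ (2 ^ Suc n)) x)"
      using double[of "2 ^ n"] by simp
    finally show ?case .
  qed simp
  have upper: "norm ((S ^^ m) x) \<le> K ^ m * norm x" for m
  proof (induction m)
    case (Suc m)
    have "norm ((S ^^ Suc m) x) \<le> K * norm ((S ^^ m) x)" using K by simp
    also have "\<dots> \<le> K * (K ^ m * norm x)" using Suc \<open>0 < K\<close> by (intro mult_left_mono) auto
    finally show ?case by (simp add: mult_ac)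
  qed simp
  obtain M where M: "\<And>y. A_norm A y \<le> M * norm y" by (rule A_norm_le_norm) blast
  have bound: "(A_norm A (S x) / K) ^ 2 ^ n \<le> \<bar>M\<bar> * norm x" for n
  proof -
    have "A_norm A (S x) ^ 2 ^ n \<le> M * norm ((S ^^ (2 ^ n)) x)"
      using lower M by (rule order_trans)
    also have "\<dots> \<le> \<bar>M\<bar> * (K ^ 2 ^ n * norm x)"
      using upper by (intro mult_mono) auto
    finally show ?thesis
      using \<open>0 < K\<close> by (simp add: power_divide field_simps)
  qed
  obtain m where m: "\<bar>M\<bar> * norm x < (A_norm A (S x) / K) ^ m"
    using real_arch_pow[OF q] by blast
  also have "\<dots> \<le> (A_norm A (S x) / K) ^ 2 ^ m"
    using q less_exp[of m] by (intro power_increasing) auto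
  finally show False using bound[of m] by simp
qed

lemma A_inner_A_adjoint_left:
  assumes "T \<in> B_A A"
  shows "A_inner A (A_adjoint A T x) y = A_inner A x (T y)"
  using A_inner_A_adjoint[OF assms, of y x] A_inner_commute by metis

text \<open>
  The previous bound is applied to \<open>S = T\<^sup>#T\<close>, which is symmetric for the \<open>A\<close>-inner product and
  satisfies \<open>\<parallel>T x\<parallel>\<^sub>A\<^sup>2 = \<langle>x, S x\<rangle>\<^sub>A\<close>. This bound makes the \<open>A\<close>-numerical radius a supremum over a
  bounded set.
\<close>
lemma A_bounded:
  assumes T: "T \<in> B_A A"
  obtains C where "0 \<le> C" and "\<And>x. A_norm A (T x) \<le> C * A_norm A x"
proof -
  have T': "bounded_clinear T" using T by (simp add: B_A_def)
  define S where "S = (\<lambda>x. A_adjoint A T (T x))"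
  have "bounded_clinear S"
    unfolding S_def by (rule bounded_clinear_compose[OF bounded_clinear_A_adjoint[OF T] T'])
  then obtain K where "0 < K" and K: "\<And>x. norm (S x) \<le> K * norm x"
    unfolding bounded_clinear_def using bounded_linear.pos_bounded by (metis mult.commute)
  have square: "(A_norm A (T x))\<^sup>2 \<le> A_norm A x * A_norm A (S x)" for x
  proof -
    have "(A_norm A (T x))\<^sup>2 = Re (A_inner A x (S x))"
      using A_inner_self[of "T x"] by (simp add: S_def flip: A_inner_A_adjoint[OF T])
    also have "\<dots> \<le> cmod (A_inner A x (S x))" by (rule complex_Re_le_cmod)
    also have "\<dots> \<le> A_norm A x * A_norm A (S x)" by (rule A_Cauchy_Schwarz)
    finally show ?thesis .
  qed
  have unit: "A_norm A (T x) \<le> sqrt K" if x: "A_norm A x = 1" for x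
  proof -
    have "(A_norm A (T x))\<^sup>2 \<le> A_norm A (S x)" using square[of x] x by simp
    also have "\<dots> \<le> K"
      by (rule A_selfadjoint_bounded[OF _ K \<open>0 < K\<close> x])
        (simp add: S_def A_inner_A_adjoint_left[OF T] A_inner_A_adjoint[OF T, symmetric])
    finally show ?thesis by (rule real_le_rsqrt)
  qed
  have "A_norm A (T x) \<le> sqrt K * A_norm A x" for x
  proof (cases "A_norm A x = 0")
    case True
    then show ?thesis using square[of x] by simp
  next
    case False
    then have pos: "A_norm A x > 0" using A_norm_nonneg[of x] by simp
    define t where "t = complex_of_real (1 / A_norm A x)"
    have t: "cmod t = 1 / A_norm A x" using pos by (simp add: t_def norm_divide)
    have "A_norm A (t *\<^sub>C T x) \<le> sqrt K"
      using unit[of "t *\<^sub>C x"] False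
      by (simp add: A_norm_scaleC t bounded_clinear_simps(2)[OF T'])
    then show ?thesis
      using pos by (simp add: A_norm_scaleC t field_simps)
  qed
  with \<open>0 < K\<close> show thesis by (intro that[of "sqrt K"]) auto
qed

abbreviation "\<AA> \<equiv> op_matrix A (\<lambda>x. 0) (\<lambda>x. 0) A"

section \<open>The numerical radius of the off-diagonal block operator\<close>

lemma A_inner_diag: "A_inner \<AA> (x, y) (x', y') = A_inner A x x' + A_inner A y y'"
  by (simp add: A_inner_def op_matrix_def cinner_prod_def)

lemma A_norm_diag: "A_norm \<AA> (x, y) = sqrt ((A_norm A x)\<^sup>2 + (A_norm A y)\<^sup>2)"
  using A_inner_self[of x] A_inner_self[of y]
  by (simp add: A_norm_def[of \<AA>] A_inner_diag)

text \<open>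
  This is the defining supremum of the numerical radius, evaluated at the pair \<open>(x, y)\<close> after scaling
  it to \<open>\<AA>\<close>-norm \<open>1\<close>.
\<close>
lemma off_diagonal_form_le:
  assumes T1: "T1 \<in> B_A A" and T2: "T2 \<in> B_A A"
  defines "w \<equiv> A_numerical_radius \<AA> (op_matrix (\<lambda>x. 0) T1 T2 (\<lambda>x. 0))"
  shows "cmod (A_inner A (T1 y) x + A_inner A (T2 x) y) \<le> w * ((A_norm A x)\<^sup>2 + (A_norm A y)\<^sup>2)"
proof -
  let ?f = "\<lambda>p. cmod (A_inner \<AA> (op_matrix (\<lambda>x. 0) T1 T2 (\<lambda>x. 0) p) p)"
  have f: "?f (u, v) = cmod (A_inner A (T1 v) u + A_inner A (T2 u) v)" for u v
    by (simp add: op_matrix_def[of "\<lambda>x. 0" T1] A_inner_diag)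
  obtain C1 where "0 \<le> C1" and C1: "\<And>x. A_norm A (T1 x) \<le> C1 * A_norm A x"
    using A_bounded[OF T1] by blast
  obtain C2 where "0 \<le> C2" and C2: "\<And>x. A_norm A (T2 x) \<le> C2 * A_norm A x"
    using A_bounded[OF T2] by blast
  have bound: "cmod (A_inner A (T1 v) u + A_inner A (T2 u) v) \<le> (C1 + C2) * (A_norm A u * A_norm A v)"
    for u v
  proof -
    have "cmod (A_inner A (T1 v) u + A_inner A (T2 u) v)
        \<le> A_norm A (T1 v) * A_norm A u + A_norm A (T2 u) * A_norm A v"
      by (rule norm_triangle_le[OF add_mono[OF A_Cauchy_Schwarz A_Cauchy_Schwarz]])
    also have "\<dots> \<le> (C1 * A_norm A v) * A_norm A u + (C2 * A_norm A u) * A_norm A v"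
      by (intro add_mono mult_right_mono C1 C2 A_norm_nonneg)
    finally show ?thesis by (simp add: algebra_simps)
  qed
  have bdd: "bdd_above (?f ` {p. A_norm \<AA> p = 1})"
  proof (intro bdd_aboveI2[where M = "C1 + C2"])
    fix p assume "p \<in> {p. A_norm \<AA> p = 1}"
    moreover obtain u v where p: "p = (u, v)" by (cases p)
    ultimately have uv: "(A_norm A u)\<^sup>2 + (A_norm A v)\<^sup>2 = 1" by (simp add: A_norm_diag)
    have "A_norm A u * A_norm A v \<le> 1"
      using sum_squares_bound[of "A_norm A u" "A_norm A v"] uv
        mult_nonneg_nonneg[OF A_norm_nonneg[of u] A_norm_nonneg[of v]] by linarith
    then have "(C1 + C2) * (A_norm A u * A_norm A v) \<le> C1 + C2"
      using \<open>0 \<le> C1\<close> \<open>0 \<le> C2\<close> by (simp add: mult_left_le)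
    then show "?f p \<le> C1 + C2"
      unfolding p f using bound[of v u] by linarith
  qed
  define s where "s = (A_norm A x)\<^sup>2 + (A_norm A y)\<^sup>2"
  show ?thesis
  proof (cases "s = 0")
    case True
    then have "A_norm A x = 0" "A_norm A y = 0" by (simp_all add: s_def add_nonneg_eq_0_iff)
    then show ?thesis using bound[of y x] by simp
  next
    case False
    then have "s > 0" by (simp add: s_def less_le)
    define t where "t = complex_of_real (1 / sqrt s)"
    have t: "(cmod t)\<^sup>2 = 1 / s" "t * cnj t = complex_of_real (1 / s)"
      using \<open>s > 0\<close> by (simp_all add: t_def norm_divide power_divide flip: of_real_mult)
    have "A_norm \<AA> (t *\<^sub>C x, t *\<^sub>C y) = sqrt (1 / s * (A_norm A x)\<^sup>2 + 1 / s * (A_norm A y)\<^sup>2)"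
      by (simp only: A_norm_diag A_norm_scaleC power_mult_distrib t)
    also have "\<dots> = sqrt (1 / s * s)" by (simp only: s_def distrib_left)
    finally have "A_norm \<AA> (t *\<^sub>C x, t *\<^sub>C y) = 1"
      using \<open>s > 0\<close> by simp
    then have "?f (t *\<^sub>C x, t *\<^sub>C y) \<le> w"
      unfolding w_def A_numerical_radius_def by (intro cSUP_upper[OF _ bdd]) simp
    also have "?f (t *\<^sub>C x, t *\<^sub>C y) = cmod (t * cnj t * (A_inner A (T1 y) x + A_inner A (T2 x) y))"
      unfolding f using T1 T2
      by (simp add: B_A_def bounded_clinear_simps A_inner_simps algebra_simps)
    also have "\<dots> = cmod (A_inner A (T1 y) x + A_inner A (T2 x) y) / s"
      using \<open>s > 0\<close> by (simp only: t norm_mult norm_of_real) simp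
    finally show ?thesis
      using \<open>s > 0\<close> by (simp add: field_simps flip: s_def)
  qed
qed

text \<open>
  The hypothesis is used on multiples \<open>t z\<close> of \<open>z\<close>, and \<open>t = 1 / (2 w)\<close> is the optimal choice. This
  step replaces the equality of norm and numerical radius for selfadjoint operators.
\<close>
lemma A_norm_le_of_form_le:
  assumes "0 \<le> w"
    and form: "\<And>x. Re (A_inner A z x) \<le> w * ((A_norm A x)\<^sup>2 + (A_norm A y)\<^sup>2)"
  shows "A_norm A z \<le> 2 * w * A_norm A y"
proof -
  have *: "t * (A_norm A z)\<^sup>2 \<le> w * (t\<^sup>2 * (A_norm A z)\<^sup>2 + (A_norm A y)\<^sup>2)" for t :: real
    using form[of "complex_of_real t *\<^sub>C z"]
    by (simp add: A_inner_simps A_inner_self A_norm_scaleC power_mult_distrib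
        flip: of_real_mult)
  have "(A_norm A z)\<^sup>2 \<le> (2 * w * A_norm A y)\<^sup>2"
  proof (cases "w = 0")
    case True
    then show ?thesis using *[of 1] by simp
  next
    case False
    with assms(1) have "w > 0" by simp
    then show ?thesis
      using *[of "1 / (2 * w)"] by (simp add: field_simps power2_eq_square)
  qed
  then show ?thesis
    by (rule power2_le_imp_le) (simp add: A_norm_nonneg assms(1))
qed

section \<open>The lower bound at a unit vector and its supremum\<close>

lemma A_adjoint_scaleC_compose:
  assumes T1: "T1 \<in> B_A A" and T2: "T2 \<in> B_A A"
  shows "A_adjoint A (\<lambda>x. d *\<^sub>C T2 (T1 x)) = (\<lambda>x. cnj d *\<^sub>C A_adjoint A T1 (A_adjoint A T2 x))"
proof (rule A_adjoint_eqI)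
  show "bounded_clinear (\<lambda>x. d *\<^sub>C T2 (T1 x))"
    using T1 T2 by (simp add: B_A_def bounded_clinear_scaleC bounded_clinear_compose)
  show "bounded_clinear (\<lambda>x. cnj d *\<^sub>C A_adjoint A T1 (A_adjoint A T2 x))"
    by (simp add: bounded_clinear_scaleC bounded_clinear_compose bounded_clinear_A_adjoint T1 T2)
  show "range (\<lambda>x. cnj d *\<^sub>C A_adjoint A T1 (A_adjoint A T2 x)) \<subseteq> closure (range A)"
    using closure_range_scaleC[OF range_A_adjoint[OF T1]] by blast
  show "A_inner A (d *\<^sub>C T2 (T1 x)) y = A_inner A x (cnj d *\<^sub>C A_adjoint A T1 (A_adjoint A T2 y))"
    for x y
    by (simp add: A_inner_simps A_inner_A_adjoint[OF T1] A_inner_A_adjoint[OF T2])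
qed

text \<open>
  With \<open>c = exp (\<i> \<phi> / 2)\<close> put \<open>K = c T1 + cnj c T2\<^sup>#\<close> and \<open>K' = cnj c T1\<^sup># + c T2\<close>; the operator
  matrix with off-diagonal entries \<open>K\<close> and \<open>K'\<close> is twice the real part of \<open>c\<close> times the given operator
  matrix. Hence both are \<open>A\<close>-bounded by \<open>2 w\<close>, and \<open>K' K\<close> is the operator on the left-hand side.
\<close>
lemma A_norm_P_plus_Re_le:
  assumes T1: "T1 \<in> B_A A" and T2: "T2 \<in> B_A A"
    and P: "P = (\<lambda>x. A_adjoint A T1 (T1 x) + T2 (A_adjoint A T2 x))"
    and x: "A_norm A x = 1"
  defines "w \<equiv> A_numerical_radius \<AA> (op_matrix (\<lambda>x. 0) T1 T2 (\<lambda>x. 0))"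
  shows "0 \<le> w"
    and "A_norm A (P x + 2 *\<^sub>C Re_A A (\<lambda>x. exp (\<i> * complex_of_real \<phi>) *\<^sub>C T2 (T1 x)) x) \<le> 4 * w\<^sup>2"
proof -
  note form = off_diagonal_form_le[OF T1 T2, folded w_def]
  have lin: "T1 (u + v) = T1 u + T1 v" "T1 (d *\<^sub>C u) = d *\<^sub>C T1 u"
    "T2 (u + v) = T2 u + T2 v" "T2 (d *\<^sub>C u) = d *\<^sub>C T2 u"
    "A_adjoint A T1 (u + v) = A_adjoint A T1 u + A_adjoint A T1 v"
    "A_adjoint A T1 (d *\<^sub>C u) = d *\<^sub>C A_adjoint A T1 u" for u v d
    using T1 T2 bounded_clinear_A_adjoint[OF T1]
    by (simp_all add: B_A_def bounded_clinear_simps)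
  have "0 \<le> w * ((A_norm A x)\<^sup>2 + (A_norm A x)\<^sup>2)"
    using form[of x x] norm_ge_zero by (rule order_trans[rotated])
  then show w0: "0 \<le> w" using x by simp
  define c where "c = exp (\<i> * complex_of_real (\<phi> / 2))"
  have cc: "c * c = exp (\<i> * complex_of_real \<phi>)"
    by (simp add: c_def flip: exp_add)
  have c1: "cmod c = 1" unfolding c_def by (rule norm_exp_i_times)
  then have ccnj: "c * cnj c = 1" by (simp flip: complex_norm_square)
  define K where "K u = c *\<^sub>C T1 u + cnj c *\<^sub>C A_adjoint A T2 u" for u
  define K' where "K' u = cnj c *\<^sub>C A_adjoint A T1 u + c *\<^sub>C T2 u" for u
  have Re_le: "Re (c * (A_inner A (T1 v) u + A_inner A (T2 u) v))
      \<le> w * ((A_norm A u)\<^sup>2 + (A_norm A v)\<^sup>2)" for u v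
  proof -
    have "Re (c * (A_inner A (T1 v) u + A_inner A (T2 u) v))
        \<le> cmod (c * (A_inner A (T1 v) u + A_inner A (T2 u) v))" by (rule complex_Re_le_cmod)
    also have "\<dots> \<le> w * ((A_norm A u)\<^sup>2 + (A_norm A v)\<^sup>2)"
      using form[of v u] by (simp only: norm_mult c1 mult_1)
    finally show ?thesis .
  qed
  have K: "A_norm A (K v) \<le> 2 * w * A_norm A v" for v
  proof (rule A_norm_le_of_form_le[OF w0])
    fix u
    have "A_inner A (K v) u = c * A_inner A (T1 v) u + cnj (c * A_inner A (T2 u) v)"
      by (simp add: K_def A_inner_simps A_inner_A_adjoint_left[OF T2]
          A_inner_commute[of v "T2 u"])
    then show "Re (A_inner A (K v) u) \<le> w * ((A_norm A u)\<^sup>2 + (A_norm A v)\<^sup>2)"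
      using Re_le[of v u] by (simp add: algebra_simps)
  qed
  have K': "A_norm A (K' u) \<le> 2 * w * A_norm A u" for u
  proof (rule A_norm_le_of_form_le[OF w0])
    fix v
    have "A_inner A (K' u) v = cnj (c * A_inner A (T1 v) u) + c * A_inner A (T2 u) v"
      by (simp add: K'_def A_inner_simps A_inner_A_adjoint_left[OF T1]
          A_inner_commute[of u "T1 v"])
    then show "Re (A_inner A (K' u) v) \<le> w * ((A_norm A v)\<^sup>2 + (A_norm A u)\<^sup>2)"
      using Re_le[of v u] by (simp add: algebra_simps)
  qed
  have "P x + 2 *\<^sub>C Re_A A (\<lambda>x. (c * c) *\<^sub>C T2 (T1 x)) x = K' (K x)"
    by (simp add: P Re_A_def A_adjoint_scaleC_compose[OF T1 T2] K_def K'_def lin scaleC_add_right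
        scaleC_scaleC ccnj mult.commute[of "cnj c" c] add_ac)
  moreover have "A_norm A (K' (K x)) \<le> 4 * w\<^sup>2"
  proof -
    have "A_norm A (K' (K x)) \<le> 2 * w * A_norm A (K x)" by (rule K')
    also have "\<dots> \<le> 2 * w * (2 * w * A_norm A x)" using w0 by (intro mult_left_mono K) simp
    finally show ?thesis by (simp add: x power2_eq_square)
  qed
  ultimately show "A_norm A (P x + 2 *\<^sub>C Re_A A (\<lambda>x. exp (\<i> * complex_of_real \<phi>) *\<^sub>C T2 (T1 x)) x) \<le> 4 * w\<^sup>2"
    by (simp add: cc)
qed

text \<open>
  Half of the cross term in the expansion of \<open>\<parallel>P x + 2 R x\<parallel>\<^sub>A\<^sup>2\<close>, where \<open>R\<close> is the real part of \<open>d S\<close> with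
  \<open>S = T2 T1\<close>. Since \<open>P\<close> is symmetric for the \<open>A\<close>-inner product, \<open>d\<close> enters only
  as a factor in front of \<open>\<langle>(P S + S P) x, x\<rangle>\<^sub>A\<close>.
\<close>
lemma Re_A_inner_P_Re:
  assumes T1: "T1 \<in> B_A A" and T2: "T2 \<in> B_A A"
    and P: "P = (\<lambda>x. A_adjoint A T1 (T1 x) + T2 (A_adjoint A T2 x))"
  shows "Re (A_inner A (P x) (2 *\<^sub>C Re_A A (\<lambda>x. d *\<^sub>C T2 (T1 x)) x))
    = Re (d * A_inner A (P (T2 (T1 x)) + T2 (T1 (P x))) x)"
proof -
  have Psym: "A_inner A (P u) v = A_inner A u (P v)" for u v
    by (simp add: P A_inner_simps A_inner_A_adjoint_left[OF T1]
        A_inner_A_adjoint_left[OF T2] A_inner_A_adjoint[OF T1] A_inner_A_adjoint[OF T2])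
  have "A_inner A (P x) (2 *\<^sub>C Re_A A (\<lambda>x. d *\<^sub>C T2 (T1 x)) x)
      = cnj d * A_inner A (P x) (T2 (T1 x))
        + d * A_inner A (P x) (A_adjoint A T1 (A_adjoint A T2 x))"
    by (simp add: Re_A_def A_adjoint_scaleC_compose[OF T1 T2] A_inner_simps
        scaleC_add_right scaleC_scaleC)
  also have "A_inner A (P x) (T2 (T1 x)) = cnj (A_inner A (P (T2 (T1 x))) x)"
    by (subst A_inner_commute) (simp add: Psym)
  also have "A_inner A (P x) (A_adjoint A T1 (A_adjoint A T2 x)) = A_inner A (T2 (T1 (P x))) x"
    by (simp add: A_inner_A_adjoint[OF T1] A_inner_A_adjoint[OF T2])
  finally show ?thesis
    by (simp add: A_inner_simps algebra_simps)
qed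

text \<open>
  The phase \<open>\<phi>\<close> is chosen, for the given \<open>x\<close>, such that the cross term of
  \<open>\<parallel>P x + 2 R x\<parallel>\<^sub>A\<^sup>2\<close> becomes \<open>2 * cmod z\<close>; the three terms of the expansion then dominate
  the three summands.
\<close>
lemma unit_vector_bound:
  assumes T1: "T1 \<in> B_A A" and T2: "T2 \<in> B_A A"
    and P: "P = (\<lambda>x. A_adjoint A T1 (T1 x) + T2 (A_adjoint A T2 x))"
    and x: "A_norm A x = 1"
  defines "w \<equiv> A_numerical_radius \<AA> (op_matrix (\<lambda>x. 0) T1 T2 (\<lambda>x. 0))"
  shows "1/16 * (A_norm A (P x))\<^sup>2 + 1/8 * A_crawford A (\<lambda>x. P (T2 (T1 x)) + T2 (T1 (P x)))
      + 1/4 * (m_A A (T2 \<circ> T1))\<^sup>2 \<le> w ^ 4"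
proof -
  define z where "z = A_inner A (P (T2 (T1 x)) + T2 (T1 (P x))) x"
  define \<phi> where "\<phi> = - Arg z"
  define R where "R = Re_A A (\<lambda>x. exp (\<i> * complex_of_real \<phi>) *\<^sub>C T2 (T1 x)) x"
  have "(A_norm A (P x + 2 *\<^sub>C R))\<^sup>2 \<le> (4 * w\<^sup>2)\<^sup>2"
    unfolding R_def w_def
    by (intro power_mono A_norm_P_plus_Re_le[OF T1 T2 P x] A_norm_nonneg)
  then have "(A_norm A (P x))\<^sup>2 + 2 * Re (A_inner A (P x) (2 *\<^sub>C R)) + 4 * (A_norm A R)\<^sup>2 \<le> 16 * w ^ 4"
    by (simp add: A_norm_add_square A_norm_scaleC power_mult_distrib flip: power_mult)
  moreover have "Re (A_inner A (P x) (2 *\<^sub>C R)) = cmod z"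
    unfolding R_def Re_A_inner_P_Re[OF T1 T2 P] z_def[symmetric] \<phi>_def phase_rotation by simp
  moreover have "A_crawford A (\<lambda>x. P (T2 (T1 x)) + T2 (T1 (P x))) \<le> cmod z"
    unfolding A_crawford_def z_def using x
    by (intro cINF_lower) (auto intro!: bdd_belowI[of _ 0])
  moreover have "(m_A A (T2 \<circ> T1))\<^sup>2 \<le> (A_norm A R)\<^sup>2"
  proof (rule power_mono)
    let ?g = "\<lambda>\<theta> y. A_norm A (Re_A A (\<lambda>y. exp (\<i> * complex_of_real \<theta>) *\<^sub>C (T2 \<circ> T1) y) y)"
    have inner0: "0 \<le> (INF y \<in> {y. A_norm A y = 1}. ?g \<theta> y)" for \<theta>
      using x A_norm_nonneg by (intro cINF_greatest) auto
    then show "0 \<le> m_A A (T2 \<circ> T1)"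
      unfolding m_A_def by (rule cINF_greatest[rotated]) simp
    have "m_A A (T2 \<circ> T1) \<le> (INF y \<in> {y. A_norm A y = 1}. ?g \<phi> y)"
      unfolding m_A_def
      by (rule cINF_lower) (use inner0 in \<open>auto intro!: bdd_belowI2[of _ 0]\<close>)
    also have "\<dots> \<le> ?g \<phi> x"
      using x A_norm_nonneg by (intro cINF_lower) (auto intro!: bdd_belowI[of _ 0])
    finally show "m_A A (T2 \<circ> T1) \<le> A_norm A R" by (simp add: R_def)
  qed
  ultimately show ?thesis by simp
qed

text \<open>
  Every quotient in the definition of the operator seminorm is the value of \<open>\<parallel>T x\<parallel>\<^sub>A\<close> at a vector of
  seminorm \<open>1\<close>, by homogeneity.
\<close>
lemma A_opnorm_square_le:
  assumes "A \<noteq> (\<lambda>x. 0)" and T: "bounded_clinear T"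
    and le: "\<And>x. A_norm A x = 1 \<Longrightarrow> (A_norm A (T x))\<^sup>2 \<le> q"
  shows "(A_opnorm A T)\<^sup>2 \<le> q"
proof -
  let ?V = "closure (range A) - {0}"
  let ?r = "\<lambda>x. A_norm A (T x) / A_norm A x"
  obtain x where "A_norm A x = 1" using ex_A_norm_one[OF assms(1)] by blast
  then have "0 \<le> q" using le[of x] by (meson order_trans zero_le_power2)
  have r: "?r x \<le> sqrt q" for x
  proof (cases "A_norm A x = 0")
    case True
    \<comment> \<open>A quotient with denominator \<open>0\<close> has the value \<open>0\<close>.\<close>
    then show ?thesis using \<open>0 \<le> q\<close> by simp
  next
    case False
    then have pos: "A_norm A x > 0" using A_norm_nonneg[of x] by simp
    define t where "t = complex_of_real (1 / A_norm A x)"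
    have t: "cmod t = 1 / A_norm A x" using pos by (simp add: t_def norm_divide)
    have "(A_norm A (T (t *\<^sub>C x)))\<^sup>2 \<le> q"
      using pos by (intro le) (simp add: A_norm_scaleC t)
    then show ?thesis
      by (intro real_le_rsqrt)
        (simp add: A_norm_scaleC t bounded_clinear_simps(2)[OF T])
  qed
  obtain y where y: "y \<in> ?V"
    using assms(1) closure_subset[of "range A"] by (auto simp: fun_eq_iff)
  have "0 \<le> ?r y" by (simp add: A_norm_nonneg)
  also have "\<dots> \<le> A_opnorm A T"
    unfolding A_opnorm_def using y r by (intro cSUP_upper) (auto intro!: bdd_aboveI2)
  finally have "0 \<le> A_opnorm A T" .
  moreover have "A_opnorm A T \<le> sqrt q"
    unfolding A_opnorm_def using y r by (intro cSUP_least) auto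
  ultimately show ?thesis
    using \<open>0 \<le> q\<close> power_mono[of "A_opnorm A T" "sqrt q" 2] by simp
qed

end

theorem theorem3p16:
  fixes A T1 T2 P :: "'a :: chilbert_space \<Rightarrow> 'a"
  assumes "positive_op A" and "A \<noteq> (\<lambda>x. 0)"
    and "T1 \<in> B_A A" and "T2 \<in> B_A A"
    and "P = (\<lambda>x. A_adjoint A T1 (T1 x) + T2 (A_adjoint A T2 x))"
  shows "(A_numerical_radius (op_matrix A (\<lambda>x. 0) (\<lambda>x. 0) A)
            (op_matrix (\<lambda>x. 0) T1 T2 (\<lambda>x. 0))) ^ 4
    \<ge> 1/16 * (A_opnorm A P)\<^sup>2
      + 1/8 * A_crawford A (\<lambda>x. P (T2 (T1 x)) + T2 (T1 (P x)))
      + 1/4 * (m_A A (T2 \<circ> T1))\<^sup>2"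
proof -
  define w where "w = A_numerical_radius (op_matrix A (\<lambda>x. 0) (\<lambda>x. 0) A)
            (op_matrix (\<lambda>x. 0) T1 T2 (\<lambda>x. 0))"
  define k where "k = 1/8 * A_crawford A (\<lambda>x. P (T2 (T1 x)) + T2 (T1 (P x)))
      + 1/4 * (m_A A (T2 \<circ> T1))\<^sup>2"
  have "bounded_clinear T1" "bounded_clinear T2"
    using assms(3,4) by (simp_all add: B_A_def)
  then have "bounded_clinear (\<lambda>x. A_adjoint A T1 (T1 x))" "bounded_clinear (\<lambda>x. T2 (A_adjoint A T2 x))"
    using assms(3,4) bounded_clinear_A_adjoint[OF assms(1)]
    by (simp_all add: bounded_clinear_compose)
  then have "bounded_clinear P"
    by (simp add: assms(5) bounded_clinear_def bounded_linear_add scaleC_add_right)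
  moreover have "(A_norm A (P x))\<^sup>2 \<le> 16 * (w ^ 4 - k)" if "A_norm A x = 1" for x
    using unit_vector_bound[OF assms(1,3,4,5) that] by (simp add: w_def k_def)
  ultimately have "(A_opnorm A P)\<^sup>2 \<le> 16 * (w ^ 4 - k)"
    by (rule A_opnorm_square_le[OF assms(1,2)])
  then show ?thesis by (simp add: w_def k_def)
qed

end
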